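(* Define graphs $H_0,H_1,\dots$ recursively: $H_0$ is a single vertex; for $k\ge1$, $H_k$ consists of a complete graph $K_{2^{k+1}-1}$ with vertices numbered $1,\dots,2^{k+1}-1$, together with $2^{k+1}-1$ disjoint copies of $H_{k-1}$, where for each $i$ the $i$-th vertex of the clique is joined by an edge to one vertex of the $i$-th copy of $H_{k-1}$. Then $\lim_{k\to\infty}\chi_{um}(H_k)/\chi_{cf}(H_k)=2$.
   Context: A path in a graph is a simple path (a single vertex counts as a path). A unique-maximum coloring of $G=(V,E)$ with $k$ colors is a function $C\colon V\to\{1,\dots,k\}$ such that on the vertex set of every path of $G$ the maximum color occurs exactly once; $\chi_{um}(G)$ is the minimum such $k$. A conflict-free coloring with $k$ colors is a function $C\colon V\to\{1,\dots,k\}$ such that for every path some color occurs exactly once on its vertices; $\chi_{cf}(G)$ is the minimum such $k$. *)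

theory Defs
  imports Complex_Main "Graph_Theory.Graph_Theory"
begin

text \<open>
  Finite simple graphs are \<open>pair_graph\<close>s: each undirected edge is represented by its two arcs.
  Simple paths are the duplicate-free nonempty vertex walks \<open>vpath\<close>.
\<close>

definition um_coloring :: "'a pair_pre_digraph \<Rightarrow> nat \<Rightarrow> ('a \<Rightarrow> nat) \<Rightarrow> bool" where
  "um_coloring G k C \<longleftrightarrow>
     (\<forall>v \<in> pverts G. C v \<in> {1..k}) \<and>
     (\<forall>p. vpath p (with_proj G) \<longrightarrow> (\<exists>!v. v \<in> set p \<and> C v = Max (C ` set p)))"

definition cf_coloring :: "'a pair_pre_digraph \<Rightarrow> nat \<Rightarrow> ('a \<Rightarrow> nat) \<Rightarrow> bool" where
  "cf_coloring G k C \<longleftrightarrow>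
     (\<forall>v \<in> pverts G. C v \<in> {1..k}) \<and>
     (\<forall>p. vpath p (with_proj G) \<longrightarrow> (\<exists>c. \<exists>!v. v \<in> set p \<and> C v = c))"

definition chi_um :: "'a pair_pre_digraph \<Rightarrow> nat" where
  "chi_um G = (LEAST k. \<exists>C. um_coloring G k C)"

definition chi_cf :: "'a pair_pre_digraph \<Rightarrow> nat" where
  "chi_cf G = (LEAST k. \<exists>C. cf_coloring G k C)"

datatype vertex = Root | Clique nat | Copy nat vertex

text \<open>
  \<open>attach n r G\<close> is the complete graph on \<open>Clique 1, \<dots>, Clique n\<close> together with \<open>n\<close> disjoint
  copies of \<open>G\<close>; \<open>Copy i v\<close> is the vertex \<open>v\<close> of the \<open>i\<close>-th copy, and \<open>Clique i\<close> is joined to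
  the vertex \<open>r i\<close> of the \<open>i\<close>-th copy.
\<close>

definition attach ::
    "nat \<Rightarrow> (nat \<Rightarrow> vertex) \<Rightarrow> vertex pair_pre_digraph \<Rightarrow> vertex pair_pre_digraph" where
  "attach n r G =
     \<lparr> pverts = Clique ` {1..n} \<union> {Copy i v | i v. i \<in> {1..n} \<and> v \<in> pverts G},
       parcs = {(Clique i, Clique j) | i j. i \<in> {1..n} \<and> j \<in> {1..n} \<and> i \<noteq> j}
             \<union> {(Copy i u, Copy i v) | i u v. i \<in> {1..n} \<and> (u, v) \<in> parcs G}
             \<union> {(Clique i, Copy i (r i)) | i. i \<in> {1..n}}
             \<union> {(Copy i (r i), Clique i) | i. i \<in> {1..n}} \<rparr>"

text \<open>
  The construction leaves open which vertex of each copy is joined to the clique, so the choice is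
  a parameter: \<open>r k i\<close> is the vertex chosen in the \<open>i\<close>-th copy when building the \<open>k\<close>-th graph.
  In the successor case, \<open>2 ^ (k + 2) - 1\<close> is \<open>2 ^ (Suc k + 1) - 1\<close>.
\<close>

primrec H :: "(nat \<Rightarrow> nat \<Rightarrow> vertex) \<Rightarrow> nat \<Rightarrow> vertex pair_pre_digraph" where
  "H r 0 = \<lparr> pverts = {Root}, parcs = {} \<rparr>"
| "H r (Suc k) = attach (2 ^ (k + 2) - 1) (r (Suc k)) (H r k)"

definition valid_choice :: "(nat \<Rightarrow> nat \<Rightarrow> vertex) \<Rightarrow> bool" where
  "valid_choice r \<longleftrightarrow> (\<forall>k \<ge> 1. \<forall>i \<in> {1..2 ^ (k + 1) - 1}. r k i \<in> pverts (H r (k - 1)))"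

lemma pair_graph_attach:
  assumes "pair_graph G" and r: "\<And>i. i \<in> {1..n} \<Longrightarrow> r i \<in> pverts G"
  shows "pair_graph (attach n r G)"
proof -
  interpret pair_graph G by fact
  have s: "(v, u) \<in> parcs G" if "(u, v) \<in> parcs G" for u v
    using that pair_sym_arcs by (auto simp: symmetric_def sym_def)
  have "finite ((\<lambda>(i, v). Copy i v) ` ({1..n} \<times> pverts G))"
    using pair_finite_verts by blast
  moreover have "{Copy i v | i v. i \<in> {1..n} \<and> v \<in> pverts G}
      = (\<lambda>(i, v). Copy i v) ` ({1..n} \<times> pverts G)" by auto
  ultimately have fv: "finite (pverts (attach n r G))" by (simp add: attach_def)
  have wf: "parcs (attach n r G) \<subseteq> pverts (attach n r G) \<times> pverts (attach n r G)"
    using r by (auto simp: attach_def dest: in_arcsD1 in_arcsD2)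
  show ?thesis
  proof
    show "fst e \<in> pverts (attach n r G)" if "e \<in> parcs (attach n r G)" for e
      using that wf by (metis SigmaD1 prod.collapse subset_iff)
    show "snd e \<in> pverts (attach n r G)" if "e \<in> parcs (attach n r G)" for e
      using that wf by (metis SigmaD2 prod.collapse subset_iff)
    show "finite (pverts (attach n r G))" by (fact fv)
    show "finite (parcs (attach n r G))"
      using fv wf by (meson finite_SigmaI finite_subset)
    show "fst e \<noteq> snd e" if "e \<in> parcs (attach n r G)" for e
      using that pair_no_loops by (auto simp: attach_def)
    show "symmetric (with_proj (attach n r G))"
      by (auto simp: symmetric_def sym_def attach_def intro: s)
  qed
qed

lemma pair_graph_H:
  assumes "valid_choice r"
  shows "pair_graph (H r k)"
proof (induction k)
  case 0
  show ?case by unfold_locales (auto simp: symmetric_def sym_def)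
next
  case (Suc k)
  have "r (Suc k) i \<in> pverts (H r k)" if "i \<in> {1..2 ^ (k + 2) - 1}" for i
    using assms that unfolding valid_choice_def by (metis Suc_eq_plus1 add_2_eq_Suc' diff_Suc_1 le_add2)
  then show ?case using Suc pair_graph_attach by (auto simp del: One_nat_def)
qed

lemma valid_choice_exists: "\<exists>r. valid_choice r"
proof
  let ?r = "\<lambda>k i. if k = 1 then Root else Clique 1"
  have c: "Clique 1 \<in> pverts (H ?r (Suc k))" for k
  proof -
    have "(2::nat) \<le> 2 ^ (k + 2)" using power_increasing[of 1 "k + 2" "2::nat"] by simp
    then have "(1::nat) \<le> 2 ^ (k + 2) - 1" by linarith
    then show ?thesis by (auto simp: attach_def simp del: power_Suc)
  qed
  show "valid_choice ?r"
    unfolding valid_choice_def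
  proof (intro allI impI ballI)
    fix k i :: nat assume "1 \<le> k"
    then consider "k = 1" | m where "k = Suc (Suc m)"
      by (metis One_nat_def not0_implies_Suc not_one_le_zero)
    then show "?r k i \<in> pverts (H ?r (k - 1))"
      using c by cases (auto simp del: H.simps(2))
  qed
qed

end

theory Submission
  imports Defs "HOL-Real_Asymp.Real_Asymp"
begin

text \<open>
  The clique of \<open>H r k\<close> forces \<open>2 ^ (k + 1) - 1\<close> colors in a conflict-free coloring. Conversely that
  many colors suffice: orient the pairs of the odd-sized color set as a regular tournament, give the
  \<open>i\<close>-th clique vertex color \<open>i\<close>, and color the \<open>i\<close>-th copy inductively with the out-neighbors of \<open>i\<close>.
  A path that uses the clique meets at most two copies \<open>a\<close> and \<open>b\<close>, and then contains the clique
  vertices \<open>a\<close> and \<open>b\<close>; one of the two colors \<open>a\<close>, \<open>b\<close> does not occur in the copies.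

  In a unique-maximum coloring the largest color of a connected set occurs only once in it. Deleting
  successively the vertices of largest color, together with the clique vertex and the copy of the same
  index, leaves a connected set each time, so about \<open>2 ^ (k + 1)\<close> colors lie above those of some copy.
  Hence the number of colors is \<open>2 ^ (k + 2) - O(k)\<close>.
\<close>

subsection \<open>Paths\<close>

lemma vwalk_arcs_subset_iff:
  "set (vwalk_arcs p) \<subseteq> E \<longleftrightarrow> successively (\<lambda>u v. (u, v) \<in> E) p"
  by (induction p rule: vwalk_arcs.induct) auto

lemma vpath_pair_iff:
  "vpath p (with_proj G) \<longleftrightarrow>
     p \<noteq> [] \<and> distinct p \<and> set p \<subseteq> pverts G \<and> successively (\<lambda>u v. (u, v) \<in> parcs G) p"
  by (auto simp: vpath_def vwalk_def vwalk_arcs_subset_iff)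

lemma vpath_rev:
  assumes "sym (parcs G)" "vpath p (with_proj G)"
  shows "vpath (rev p) (with_proj G)"
proof -
  have "successively (\<lambda>u v. (v, u) \<in> parcs G) p"
    using assms by (auto simp: vpath_pair_iff dest: symD elim!: successively_mono)
  then show ?thesis
    using assms(2) by (simp add: vpath_pair_iff)
qed

text \<open>A discrete intermediate value principle: the first element satisfying \<open>Q\<close>
  is not the head, so its predecessor supplies the crossing. That \<open>w\<close> lies in
  \<open>xs\<close>, strictly before \<open>v\<close>, later places a clique vertex on a known side
  of \<open>v\<close>.\<close>

lemma successively_crossing:
  assumes "successively P (xs @ [v])" "xs \<noteq> []" "\<not> Q (hd xs)" "Q v"
  shows "\<exists>w \<in> set xs. \<exists>w' \<in> set (xs @ [v]). P w w' \<and> \<not> Q w \<and> Q w'"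
  using assms
proof (induction xs)
  case (Cons x xs)
  show ?case
  proof (cases "xs = []")
    case False
    then show ?thesis
      using Cons by (cases "Q (hd xs)") (auto simp: successively_Cons)
  qed (use Cons in auto)
qed simp

lemma rtrancl_imp_distinct_successively:
  assumes "(u, v) \<in> R\<^sup>*"
  shows "\<exists>p. p \<noteq> [] \<and> distinct p \<and> hd p = u \<and> last p = v \<and> successively (\<lambda>x y. (x, y) \<in> R) p"
  using assms
proof (induction rule: converse_rtrancl_induct)
  case base
  show ?case by (rule exI[of _ "[v]"]) simp
next
  case (step u w)
  then obtain p where p: "p \<noteq> []" "distinct p" "hd p = w" "last p = v"
      "successively (\<lambda>x y. (x, y) \<in> R) p"
    by blast
  show ?case
  \<comment> \<open>If \<open>u\<close> already occurs on \<open>p\<close>, prepending it would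
    close a cycle; the path is cut back to start at that occurrence instead.\<close>
  proof (cases "u \<in> set p")
    case True
    then obtain xs ys where "p = xs @ u # ys" by (meson split_list)
    then show ?thesis
      using p by (intro exI[of _ "u # ys"]) (auto simp: successively_append_iff)
  next
    case False
    then show ?thesis
      using p step.hyps by (intro exI[of _ "u # p"]) (auto simp: successively_Cons)
  qed
qed

lemma successively_set_subset:
  assumes "successively (\<lambda>x y. (x, y) \<in> R \<inter> S \<times> S) p" "hd p \<in> S"
  shows "set p \<subseteq> S"
  using assms by (induction p) (auto simp: successively_Cons)

section \<open>Connected vertex sets\<close>

definition connected_in :: "'a pair_pre_digraph \<Rightarrow> 'a set \<Rightarrow> bool" where
  "connected_in G S \<longleftrightarrow> (\<forall>u \<in> S. \<forall>v \<in> S. (u, v) \<in> (parcs G \<inter> S \<times> S)\<^sup>*)"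

lemma connected_in_vpath:
  assumes "connected_in G S" "S \<subseteq> pverts G" "u \<in> S" "v \<in> S"
  obtains p where "vpath p (with_proj G)" "set p \<subseteq> S" "u \<in> set p" "v \<in> set p"
proof -
  have "(u, v) \<in> (parcs G \<inter> S \<times> S)\<^sup>*"
    using assms unfolding connected_in_def by blast
  then obtain p where p: "p \<noteq> []" "distinct p" "hd p = u" "last p = v"
      "successively (\<lambda>x y. (x, y) \<in> parcs G \<inter> S \<times> S) p"
    using rtrancl_imp_distinct_successively by metis
  have "set p \<subseteq> S"
    using successively_set_subset[OF p(5)] p(3) assms(3) by blast
  moreover have "successively (\<lambda>x y. (x, y) \<in> parcs G) p"
    using p(5) by (rule successively_mono) auto
  ultimately have "vpath p (with_proj G)"
    using p assms by (auto simp: vpath_pair_iff)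
  then show thesis
    using that \<open>set p \<subseteq> S\<close> p hd_in_set[of p] last_in_set[of p] by simp
qed

subsection \<open>The coloring conditions on paths\<close>

text \<open>The path conditions are separated from the palette \<open>{1..k}\<close>, so that colors
  can be counted as the cardinality of an image and copies can be colored from arbitrary
  palettes.\<close>

definition um_on :: "'a pair_pre_digraph \<Rightarrow> ('a \<Rightarrow> nat) \<Rightarrow> bool" where
  "um_on G C \<longleftrightarrow>
     (\<forall>p. vpath p (with_proj G) \<longrightarrow> (\<exists>!v. v \<in> set p \<and> C v = Max (C ` set p)))"

definition cf_on :: "'a pair_pre_digraph \<Rightarrow> ('a \<Rightarrow> nat) \<Rightarrow> bool" where
  "cf_on G C \<longleftrightarrow> (\<forall>p. vpath p (with_proj G) \<longrightarrow> (\<exists>c. \<exists>!v. v \<in> set p \<and> C v = c))"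

lemma um_coloring_iff: "um_coloring G k C \<longleftrightarrow> C ` pverts G \<subseteq> {1..k} \<and> um_on G C"
  unfolding um_coloring_def um_on_def by blast

lemma cf_coloring_iff: "cf_coloring G k C \<longleftrightarrow> C ` pverts G \<subseteq> {1..k} \<and> cf_on G C"
  unfolding cf_coloring_def cf_on_def by blast

text \<open>Two vertices attaining the maximum over \<open>S\<close> lie on a common path inside
  \<open>S\<close>; the maximum over that path is the same, and it is attained only once
  there.\<close>

lemma um_on_connected_Max_unique:
  assumes "um_on G C" "connected_in G S" "S \<subseteq> pverts G" "finite S"
    and "u \<in> S" "v \<in> S" "C u = Max (C ` S)" "C v = Max (C ` S)"
  shows "u = v"
proof -
  obtain p where p: "vpath p (with_proj G)" "set p \<subseteq> S" "u \<in> set p" "v \<in> set p"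
    by (rule connected_in_vpath[OF assms(2,3,5,6)])
  have "Max (C ` set p) = Max (C ` S)"
  proof (rule Max_eqI)
    show "Max (C ` S) \<in> C ` set p"
      using p(3) assms(7) by (metis imageI)
  qed (use p(2) \<open>finite S\<close> in auto)
  then have "u \<in> set p \<and> C u = Max (C ` set p)" "v \<in> set p \<and> C v = Max (C ` set p)"
    using p assms(7,8) by simp_all
  moreover have "\<exists>!v. v \<in> set p \<and> C v = Max (C ` set p)"
    using assms(1) p unfolding um_on_def by blast
  ultimately show ?thesis by blast
qed

subsection \<open>Attaching copies to a clique\<close>

text \<open>What is left of an attached graph when only the indices in \<open>I\<close> are kept;
  these sets carry the induction behind the lower bound.\<close>

definition part :: "nat set \<Rightarrow> vertex set \<Rightarrow> vertex set" where
  "part I V = Clique ` I \<union> {Copy i v | i v. i \<in> I \<and> v \<in> V}"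

lemma pverts_attach: "pverts (attach n r G) = part {1..n} (pverts G)"
  by (simp add: attach_def part_def)

lemma parcs_attach_iff [simp]:
  "(Clique i, Clique j) \<in> parcs (attach n r G) \<longleftrightarrow> i \<in> {1..n} \<and> j \<in> {1..n} \<and> i \<noteq> j"
  "(Copy i u, Copy j v) \<in> parcs (attach n r G) \<longleftrightarrow> i \<in> {1..n} \<and> i = j \<and> (u, v) \<in> parcs G"
  "(Clique i, Copy j v) \<in> parcs (attach n r G) \<longleftrightarrow> i \<in> {1..n} \<and> i = j \<and> v = r i"
  "(Copy j v, Clique i) \<in> parcs (attach n r G) \<longleftrightarrow> i \<in> {1..n} \<and> i = j \<and> v = r i"
  by (auto simp: attach_def)

lemma vertex_attach_cases:
  assumes "v \<in> pverts (attach n r G)"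
  obtains i where "v = Clique i" "i \<in> {1..n}" | i w where "v = Copy i w" "i \<in> {1..n}" "w \<in> pverts G"
  using assms by (auto simp: pverts_attach part_def)

lemma parcs_attach_not_Root:
  "(Root, v) \<notin> parcs (attach n r G)" "(v, Root) \<notin> parcs (attach n r G)"
  by (auto simp: attach_def)

lemma parcs_attach_leave_Copy:
  assumes "(u, v) \<in> parcs (attach n r G)" "u \<in> range (Copy i)" "v \<notin> range (Copy i)"
  shows "v = Clique i"
  using assms by (cases v) (auto simp: parcs_attach_not_Root)

lemma parcs_attach_enter_Copy:
  assumes "(u, v) \<in> parcs (attach n r G)" "u \<notin> range (Copy i)" "v \<in> range (Copy i)"
  shows "u = Clique i"
  using assms by (cases u) (auto simp: parcs_attach_not_Root)

lemma vpath_map_Copy_iff: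
  assumes "i \<in> {1..n}"
  shows "vpath (map (Copy i) p) (with_proj (attach n r G)) \<longleftrightarrow> vpath p (with_proj G)"
  using assms
  by (auto simp: vpath_pair_iff pverts_attach part_def successively_map distinct_map inj_on_def)

lemma um_on_Copy:
  assumes "um_on (attach n r G) C" "i \<in> {1..n}"
  shows "um_on G (C \<circ> Copy i)"
  unfolding um_on_def
proof (intro allI impI)
  fix p assume "vpath p (with_proj G)"
  then have "\<exists>!v. v \<in> set (map (Copy i) p) \<and> C v = Max (C ` set (map (Copy i) p))"
    using assms vpath_map_Copy_iff unfolding um_on_def by blast
  moreover have "C ` set (map (Copy i) p) = (C \<circ> Copy i) ` set p"
    by (simp add: image_image)
  ultimately show "\<exists>!v. v \<in> set p \<and> (C \<circ> Copy i) v = Max ((C \<circ> Copy i) ` set p)"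
    by (auto simp del: image_comp)
qed

text \<open>Without clique vertices a path stays in the copy where it starts, because the only exit
  from the \<open>i\<close>-th copy is \<open>Clique i\<close>.\<close>

lemma vpath_attach_no_clique:
  assumes p: "vpath p (with_proj (attach n r G))" and no: "\<And>i. Clique i \<notin> set p"
  obtains i q where "i \<in> {1..n}" "p = map (Copy i) q" "vpath q (with_proj G)"
proof -
  have "p \<noteq> []" "hd p \<in> pverts (attach n r G)"
    using p by (auto simp: vpath_pair_iff)
  then obtain i w where i: "hd p = Copy i w" "i \<in> {1..n}"
    using no by (metis hd_in_set vertex_attach_cases)
  have "v \<in> range (Copy i)" if v: "v \<in> set p" for v
  proof (rule ccontr)
    assume nv: "v \<notin> range (Copy i)"
    obtain xs ys where xs: "p = xs @ v # ys"
      using v by (meson split_list)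
    have "successively (\<lambda>u v. (u, v) \<in> parcs (attach n r G)) (xs @ [v])"
      using p xs by (auto simp: vpath_pair_iff successively_append_iff)
    moreover have "xs \<noteq> []" "hd xs \<in> range (Copy i)"
      using i xs nv by (cases xs; auto)+
    ultimately have "\<exists>w \<in> set xs. \<exists>w' \<in> set (xs @ [v]). (w, w') \<in> parcs (attach n r G) \<and>
        \<not> w \<notin> range (Copy i) \<and> w' \<notin> range (Copy i)"
      using nv by (intro successively_crossing) simp_all
    then have "Clique i \<in> set (xs @ [v])"
      using parcs_attach_leave_Copy by blast
    then show False
      using no xs by auto
  qed
  then obtain q where "p = map (Copy i) q"
    by (metis ex_map_conv rangeE)
  then show thesis
    using that i p vpath_map_Copy_iff by blast
qed

section \<open>How paths enter and leave copies\<close>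

lemma vpath_attach_enter_Copy:
  assumes "vpath (xs @ Copy i v # ys) (with_proj (attach n r G))"
    and "hd (xs @ Copy i v # ys) \<notin> range (Copy i)"
  shows "Clique i \<in> set xs"
proof -
  have "successively (\<lambda>u v. (u, v) \<in> parcs (attach n r G)) (xs @ [Copy i v])"
    using assms by (auto simp: vpath_pair_iff successively_append_iff)
  moreover have "xs \<noteq> []" "hd xs \<notin> range (Copy i)"
    using assms by (cases xs; auto)+
  ultimately have "\<exists>w \<in> set xs. \<exists>w' \<in> set (xs @ [Copy i v]). (w, w') \<in> parcs (attach n r G) \<and>
      w \<notin> range (Copy i) \<and> w' \<in> range (Copy i)"
    by (intro successively_crossing) simp_all
  then show ?thesis
    using parcs_attach_enter_Copy by blast
qed

text \<open>A path with both ends outside the \<open>i\<close>-th copy would pass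
  \<open>Clique i\<close> once to enter and once to leave, which a simple path cannot do. Hence a
  path using the clique meets at most two copies, one for each end.\<close>

lemma vpath_attach_end_in_Copy:
  assumes p: "vpath p (with_proj (attach n r G))" and sym: "sym (parcs (attach n r G))"
    and v: "Copy i v \<in> set p"
  shows "hd p \<in> range (Copy i) \<or> last p \<in> range (Copy i)"
proof (rule ccontr)
  assume contra: "\<not> ?thesis"
  obtain xs ys where xs: "p = xs @ Copy i v # ys"
    using v by (meson split_list)
  have "vpath (rev ys @ Copy i v # rev xs) (with_proj (attach n r G))"
    using vpath_rev[OF sym p] xs by simp
  moreover have "hd (rev ys @ Copy i v # rev xs) = last p"
    using xs by (cases ys rule: rev_cases) auto
  ultimately have "Clique i \<in> set ys"
    using vpath_attach_enter_Copy[of "rev ys" i v "rev xs"] contra by auto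
  moreover have "Clique i \<in> set xs"
    using vpath_attach_enter_Copy p xs contra by blast
  ultimately show False
    using p xs by (auto simp: vpath_pair_iff)
qed

text \<open>Cutting the path at \<open>Clique j\<close> gives a piece that starts outside the
  \<open>i\<close>-th copy and later enters it, hence passes \<open>Clique i\<close>. Reversal
  covers the case where \<open>Clique j\<close> comes after the copy vertex.\<close>

lemma vpath_attach_Clique_mem:
  assumes p: "vpath p (with_proj (attach n r G))" and sym: "sym (parcs (attach n r G))"
    and v: "Copy i v \<in> set p" and j: "Clique j \<in> set p"
  shows "Clique i \<in> set p"
proof -
  have *: "Clique i \<in> set q"
    if q: "vpath q (with_proj (attach n r G))" "q = xs @ Copy i v # ys" "Clique j \<in> set xs"
    for q xs ys
  proof -
    obtain as bs where xs: "xs = as @ Clique j # bs"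
      using q(3) by (meson split_list)
    have "vpath ((Clique j # bs) @ Copy i v # ys) (with_proj (attach n r G))"
      using that xs by (auto simp: vpath_pair_iff successively_append_iff)
    then show ?thesis
      using vpath_attach_enter_Copy[of "Clique j # bs" i v ys] that xs by auto
  qed
  obtain xs ys where xs: "p = xs @ Copy i v # ys"
    using v by (meson split_list)
  then consider "Clique j \<in> set xs" | "Clique j \<in> set ys"
    using j by auto
  then show ?thesis
  proof cases
    case 1
    then show ?thesis using * p xs by blast
  next
    case 2
    then show ?thesis
      using *[OF vpath_rev[OF sym p], of "rev ys" "rev xs"] xs by auto
  qed
qed

subsection \<open>Lower bounds\<close>

text \<open>Within the set, every copy vertex reaches the clique vertex of its own index through the
  attaching vertex, and the clique vertices are pairwise adjacent.\<close>

lemma connected_in_part: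
  assumes G: "pair_graph G" "connected_in G (pverts G)" and r: "\<And>i. i \<in> {1..n} \<Longrightarrow> r i \<in> pverts G"
    and I: "I \<subseteq> {1..n}"
  shows "connected_in (attach n r G) (part I (pverts G))"
proof -
  define R where "R = parcs (attach n r G) \<inter> part I (pverts G) \<times> part I (pverts G)"
  interpret A: pair_graph "attach n r G"
    using G(1) r by (rule pair_graph_attach)
  have "sym (parcs (attach n r G))"
    using A.pair_sym_arcs by (simp add: symmetric_def)
  then have "sym R"
    unfolding R_def by (auto simp: sym_def)
  then have symR: "sym (R\<^sup>*)"
    by (rule sym_rtrancl)
  have cc: "(Clique i, Clique j) \<in> R\<^sup>*" if "i \<in> I" "j \<in> I" for i j
  proof (cases "i = j")
    case False
    then have "(Clique i, Clique j) \<in> R"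
      using that subsetD[OF I] by (simp add: R_def part_def)
    then show ?thesis by blast
  qed simp
  have copy: "(Copy i u, Copy i v) \<in> R\<^sup>*" if i: "i \<in> I" and uv: "u \<in> pverts G" "v \<in> pverts G" for i u v
  proof -
    have "(u, v) \<in> (parcs G \<inter> pverts G \<times> pverts G)\<^sup>*"
      using G uv unfolding connected_in_def by blast
    then show ?thesis
    proof (induction rule: rtrancl_induct)
      case (step y z)
      then have "(Copy i y, Copy i z) \<in> R"
        using i I by (auto simp: R_def part_def)
      with step show ?case by (meson rtrancl.rtrancl_into_rtrancl)
    qed simp
  qed
  have to_clique: "\<exists>i \<in> I. (u, Clique i) \<in> R\<^sup>*" if u: "u \<in> part I (pverts G)" for u
  proof -
    consider i where "u = Clique i" "i \<in> I" | i w where "u = Copy i w" "i \<in> I" "w \<in> pverts G"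
      using u by (auto simp: part_def)
    then show ?thesis
    proof cases
      case 2
      then have "(Copy i (r i), Clique i) \<in> R"
        using I r by (auto simp: R_def part_def)
      moreover have "(u, Copy i (r i)) \<in> R\<^sup>*"
        using copy 2 r I by blast
      ultimately show ?thesis
        using 2 by (meson rtrancl.rtrancl_into_rtrancl)
    qed auto
  qed
  show ?thesis
    unfolding connected_in_def R_def[symmetric]
    by (meson to_clique cc symR rtrancl_trans symD)
qed

text \<open>Each deleted index costs at least one color. The process stops at a single index, whose
  copy still shows \<open>L\<close> colors, so \<open>card I - 1\<close> further colors are gained;
  this explains the \<open>+ 1\<close>.\<close>

lemma card_colors_part_ge:
  assumes G: "pair_graph G" "connected_in G (pverts G)" and r: "\<And>i. i \<in> {1..n} \<Longrightarrow> r i \<in> pverts G"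
    and C: "um_on (attach n r G) C"
    and L: "\<And>D. um_on G D \<Longrightarrow> L \<le> card (D ` pverts G)"
    and I: "I \<subseteq> {1..n}" "I \<noteq> {}"
  shows "L + card I \<le> card (C ` part I (pverts G)) + 1"
proof -
  interpret A: pair_graph "attach n r G"
    using G(1) r by (rule pair_graph_attach)
  have sub: "part J (pverts G) \<subseteq> pverts (attach n r G)" if "J \<subseteq> {1..n}" for J
    using that by (auto simp: part_def pverts_attach)
  have fin: "finite (part J (pverts G))" if "J \<subseteq> {1..n}" for J
    using sub[OF that] A.pair_finite_verts finite_subset by blast
  have "finite I"
    using I finite_subset by blast
  then show ?thesis
    using I
  proof (induction "card I" arbitrary: I rule: less_induct)
    case less
    show ?case
    proof (cases "card I = 1")
      case True
      then obtain i where i: "I = {i}"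
        using card_1_singletonE by blast
      then have "L \<le> card ((C \<circ> Copy i) ` pverts G)"
        using L um_on_Copy C less.prems by blast
      also have "\<dots> \<le> card (C ` part I (pverts G))"
        using fin[OF less.prems(2)] i by (intro card_mono) (auto simp: part_def)
      finally show ?thesis using True by simp
    next
      case False
      define S where "S = part I (pverts G)"
      have S: "finite S" "S \<subseteq> pverts (attach n r G)" "S \<noteq> {}"
        using fin sub less.prems by (auto simp: S_def part_def)
      then have "Max (C ` S) \<in> C ` S" by simp
      then obtain v where v: "v \<in> S" "C v = Max (C ` S)" by (metis imageE)
      \<comment> \<open>The vertex of largest color may lie in the clique or in a copy; removing its
        whole index keeps the rest of the form \<open>part J\<close>, hence connected.\<close>
      then obtain i where i: "i \<in> I" "v = Clique i \<or> v \<in> range (Copy i)"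
        by (auto simp: S_def part_def)
      let ?J = "I - {i}"
      have card_J: "card ?J = card I - 1" "card I > 0"
        using i less.prems by (auto simp: card_gt_0_iff)
      have "?J \<noteq> {}"
        using False card_J by (intro notI) simp
      then have IH: "L + card ?J \<le> card (C ` part ?J (pverts G)) + 1"
        using less card_J by (intro less.hyps) auto
      have "part ?J (pverts G) \<subseteq> S - {v}"
        using i by (auto simp: S_def part_def)
      moreover have "Max (C ` S) \<notin> C ` (S - {v})"
      proof
        assume "Max (C ` S) \<in> C ` (S - {v})"
        then obtain w where w: "Max (C ` S) = C w" "w \<in> S - {v}"
          by (rule imageE)
        have "connected_in (attach n r G) S"
          unfolding S_def using G r less.prems(2) by (rule connected_in_part)
        then have "v = w"
          using um_on_connected_Max_unique[OF C _ S(2,1) v(1) _ v(2)] w by simp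
        then show False
          using w(2) by simp
      qed
      ultimately have "C ` part ?J (pverts G) \<subseteq> C ` S - {Max (C ` S)}"
        by blast
      then have "C ` part ?J (pverts G) \<subset> C ` S"
        using \<open>Max (C ` S) \<in> C ` S\<close> by blast
      then have "card (C ` part ?J (pverts G)) < card (C ` S)"
        using S by (intro psubset_card_mono) auto
      then show ?thesis
        using IH card_J unfolding S_def by linarith
    qed
  qed
qed

section \<open>The recursive graphs: connectedness and lower bounds\<close>

lemma valid_choice_Suc:
  assumes "valid_choice r" "i \<in> {1..2 ^ (k + 2) - 1}"
  shows "r (Suc k) i \<in> pverts (H r k)"
  using assms unfolding valid_choice_def
  by (metis Suc_eq_plus1 add_2_eq_Suc' diff_Suc_1 le_add2)

lemma sym_parcs_H:
  assumes "valid_choice r"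
  shows "sym (parcs (H r k))"
proof -
  interpret pair_graph "H r k"
    using assms by (rule pair_graph_H)
  show ?thesis
    using pair_sym_arcs by (simp add: symmetric_def)
qed

lemma connected_in_H:
  assumes "valid_choice r"
  shows "connected_in (H r k) (pverts (H r k))"
proof (induction k)
  case 0
  show ?case by (simp add: connected_in_def)
next
  case (Suc k)
  then show ?case
    unfolding H.simps pverts_attach
    using assms pair_graph_H valid_choice_Suc by (intro connected_in_part) auto
qed

lemma two_le_two_power: "2 \<le> (2::nat) ^ (k + 2)"
  using power_increasing[of 1 "k + 2" "2::nat"] by simp

text \<open>Each level adds \<open>2 ^ (k + 2) - 2\<close> colors, one less than the clique size;
  starting from one color this sums to \<open>2 ^ (k + 2) - 2 * k - 3\<close>. The additive form
  avoids truncated subtraction.\<close>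

lemma um_on_H_card_ge:
  assumes "valid_choice r" "um_on (H r k) C"
  shows "2 ^ (k + 2) \<le> card (C ` pverts (H r k)) + 2 * k + 3"
  using assms(2)
proof (induction k arbitrary: C)
  case 0
  show ?case by simp
next
  case (Suc k)
  let ?n = "2 ^ (k + 2) - 1 :: nat"
  have L: "2 ^ (k + 2) - (2 * k + 3) \<le> card (D ` pverts (H r k))" if "um_on (H r k) D" for D
    using Suc.IH[OF that] by linarith
  have "2 ^ (k + 2) - (2 * k + 3) + card {1..?n} \<le> card (C ` part {1..?n} (pverts (H r k))) + 1"
  proof (rule card_colors_part_ge)
    show "um_on (attach ?n (r (Suc k)) (H r k)) C"
      using Suc.prems by simp
    show "{1..?n} \<noteq> {}"
      using two_le_two_power[of k] by (simp del: power_Suc)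
  qed (use assms pair_graph_H connected_in_H valid_choice_Suc L in auto)
  then show ?case
    using two_le_two_power[of k] unfolding H.simps pverts_attach by simp
qed

lemma cf_coloring_clique_card_le:
  assumes "cf_coloring (attach n r G) k C"
  shows "n \<le> k"
proof -
  have "inj_on (C \<circ> Clique) {1..n}"
  proof (rule inj_onI, rule ccontr)
    fix i j assume ij: "i \<in> {1..n}" "j \<in> {1..n}" "(C \<circ> Clique) i = (C \<circ> Clique) j" "i \<noteq> j"
    \<comment> \<open>Two adjacent vertices of equal color form a path on which no color occurs
      exactly once.\<close>
    then have "vpath [Clique i, Clique j] (with_proj (attach n r G))"
      by (auto simp: vpath_pair_iff pverts_attach part_def)
    then have "\<exists>c. \<exists>!v. v \<in> set [Clique i, Clique j] \<and> C v = c"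
      using assms unfolding cf_coloring_def by blast
    then obtain c where c: "\<exists>!v. v \<in> set [Clique i, Clique j] \<and> C v = c" ..
    then obtain v where "v \<in> set [Clique i, Clique j]" "C v = c" by blast
    then have "Clique i \<in> set [Clique i, Clique j] \<and> C (Clique i) = c"
        "Clique j \<in> set [Clique i, Clique j] \<and> C (Clique j) = c"
      using ij(3) by auto
    then have "Clique i = Clique j"
      using c by blast
    then show False
      using ij(4) by simp
  qed
  moreover have "(C \<circ> Clique) ` {1..n} \<subseteq> {1..k}"
    using assms unfolding cf_coloring_def by (force simp: pverts_attach part_def)
  ultimately show ?thesis
    using card_inj_on_le[of "C \<circ> Clique" "{1..n}" "{1..k}"] by simp
qed

subsection \<open>Upper bounds\<close>

lemma vpath_H_0: "vpath p (with_proj (H r 0)) \<Longrightarrow> set p = {Root}"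
  by (metis H.simps(1) pair_pre_digraph.select_convs(1) set_empty2 subset_singletonD vpath_pair_iff)

text \<open>All copies share one coloring with \<open>U\<close> colors and the clique receives
  \<open>n\<close> new larger ones, so on a path meeting the clique the maximum sits at a single
  clique vertex. The bound solves the recurrence \<open>U + n\<close> with initial value 1.\<close>

lemma um_coloring_H_exists:
  "\<exists>C. um_coloring (H r k) (2 ^ (k + 2) - k - 3) C"
proof (induction k)
  case 0
  have "um_coloring (H r 0) 1 (\<lambda>_. 1)"
    unfolding um_coloring_def
  proof (intro conjI allI impI)
    fix p assume "vpath p (with_proj (H r 0))"
    then have "set p = {Root}"
      by (rule vpath_H_0)
    then show "\<exists>!v. v \<in> set p \<and> 1 = Max ((\<lambda>_. 1::nat) ` set p)" by auto
  qed simp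
  then show ?case by (auto simp: numeral_eq_Suc)
next
  case (Suc k)
  define U :: nat where "U = 2 ^ (k + 2) - k - 3"
  define n :: nat where "n = 2 ^ (k + 2) - 1"
  obtain D where D: "D ` pverts (H r k) \<subseteq> {1..U}" "um_on (H r k) D"
    using Suc unfolding um_coloring_iff U_def by blast
  \<comment> \<open>The value at \<open>Root\<close> is arbitrary, since \<open>Root\<close> is not
    a vertex of an attached graph.\<close>
  define C where "C = (\<lambda>v. case v of Root \<Rightarrow> 0 | Clique i \<Rightarrow> U + i | Copy i w \<Rightarrow> D w)"
  have "um_on (attach n (r (Suc k)) (H r k)) C"
    unfolding um_on_def
  proof (intro allI impI)
    fix p assume p: "vpath p (with_proj (attach n (r (Suc k)) (H r k)))"
    then have verts: "p \<noteq> []" "set p \<subseteq> pverts (attach n (r (Suc k)) (H r k))"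
      by (auto simp: vpath_pair_iff)
    show "\<exists>!v. v \<in> set p \<and> C v = Max (C ` set p)"
    proof (cases "\<exists>i. Clique i \<in> set p")
      case False
      then obtain i q where q: "p = map (Copy i) q" "vpath q (with_proj (H r k))"
        using p vpath_attach_no_clique by metis
      have "C ` set p = D ` set q"
        by (simp add: q image_image C_def)
      moreover have "\<exists>!v. v \<in> set q \<and> D v = Max (D ` set q)"
        using D q unfolding um_on_def by blast
      ultimately show ?thesis
        unfolding q by (auto simp: C_def)
    next
      case True
      then obtain j where j: "Clique j \<in> set p" by blast
      have "Max (C ` set p) \<in> C ` set p"
        using verts by simp
      then obtain v where v: "v \<in> set p" "C v = Max (C ` set p)"
        by (metis imageE)
      have clique: "\<exists>i. w = Clique i" if w: "w \<in> set p" "C w = Max (C ` set p)" for w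
      proof -
        have "w \<in> pverts (attach n (r (Suc k)) (H r k))"
          using w verts by blast
        moreover have False if "w = Copy i x" "x \<in> pverts (H r k)" for i x
        proof -
          have "C (Clique j) \<le> C w"
            using w j by simp
          moreover have "j > 0"
            using j verts by (auto simp: pverts_attach part_def)
          moreover have "D x \<le> U"
            using D that by auto
          ultimately show False
            using that by (simp add: C_def)
        qed
        ultimately show ?thesis
          by (metis vertex_attach_cases)
      qed
      have "w = v" if "w \<in> set p" "C w = Max (C ` set p)" for w
        using clique[OF that] clique[OF v] that v by (auto simp: C_def)
      then show ?thesis
        using v by blast
    qed
  qed
  moreover have "C ` pverts (attach n (r (Suc k)) (H r k)) \<subseteq> {1..U + n}"
    using D by (force simp: pverts_attach part_def C_def)
  moreover have "U + n = 2 ^ (Suc k + 2) - Suc k - 3"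
  proof -
    have "k + 3 \<le> 2 ^ (k + 2)"
      by (induction k) auto
    then show ?thesis
      by (simp add: U_def n_def)
  qed
  ultimately show ?case
    unfolding um_coloring_iff by (auto simp: n_def)
qed

section \<open>Regular tournaments and conflict-free colorings\<close>

lemma regular_tournament:
  fixes m n :: nat
  assumes "n = 2 * m + 1"
  obtains D :: "nat \<Rightarrow> nat set"
  where "\<And>a. a \<in> {1..n} \<Longrightarrow> D a \<subseteq> {1..n} \<and> card (D a) = m \<and> a \<notin> D a"
    and "\<And>a b. a \<in> D b \<Longrightarrow> b \<notin> D a"
proof
  \<comment> \<open>The out-neighbors of \<open>a\<close> are its next \<open>m\<close> successors
    in the cyclic order of \<open>{1..n}\<close>; the second interval is the wrap-around, empty by
    truncation if \<open>a + m \<le> n\<close>. Going back from a successor takes at least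
    \<open>m + 1\<close> steps, so no pair is oriented both ways.\<close>
  define D where "D = (\<lambda>a. {a<..min (a + m) n} \<union> {1..a + m - n} :: nat set)"
  fix a b
  show "D a \<subseteq> {1..n} \<and> card (D a) = m \<and> a \<notin> D a" if "a \<in> {1..n}"
  proof -
    have "card (D a) = card {a<..min (a + m) n} + card {1..a + m - n}"
      unfolding D_def using assms that by (intro card_Un_disjoint) auto
    then show ?thesis
      using assms that by (auto simp: D_def min_def)
  qed
  show "b \<notin> D a" if "a \<in> D b"
    using that assms by (auto simp: D_def)
qed

text \<open>On a path using the clique, a clique vertex is found whose color is absent from every
  copy met; injectivity of \<open>e\<close> then makes that color unique. The map \<open>e\<close>
  translates tournament vertices into colors of an arbitrary palette.\<close>

lemma cf_on_attach:
  assumes sym: "sym (parcs (attach n r G))"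
    and D: "\<And>a. a \<in> {1..n} \<Longrightarrow> a \<notin> D a" "\<And>a b. a \<in> D b \<Longrightarrow> b \<notin> D a"
    and e: "inj_on e {1..n}"
    and sub: "\<And>i. i \<in> {1..n} \<Longrightarrow> D i \<subseteq> {1..n}"
    and C': "\<And>i. i \<in> {1..n} \<Longrightarrow> C' i ` pverts G \<subseteq> e ` D i" "\<And>i. i \<in> {1..n} \<Longrightarrow> cf_on G (C' i)"
    and C: "\<And>i. C (Clique i) = e i" "\<And>i v. C (Copy i v) = C' i v"
  shows "cf_on (attach n r G) C"
  unfolding cf_on_def
proof (intro allI impI)
  fix p assume p: "vpath p (with_proj (attach n r G))"
  have verts: "set p \<subseteq> part {1..n} (pverts G)"
    using p by (auto simp: vpath_pair_iff pverts_attach)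
  show "\<exists>c. \<exists>!v. v \<in> set p \<and> C v = c"
  proof (cases "\<exists>i. Clique i \<in> set p")
    case False
    then obtain i q where q: "i \<in> {1..n}" "p = map (Copy i) q" "vpath q (with_proj G)"
      using p vpath_attach_no_clique by metis
    then obtain c where "\<exists>!v. v \<in> set q \<and> C' i v = c"
      using C'(2) unfolding cf_on_def by blast
    then have "\<exists>!v. v \<in> set p \<and> C v = c"
      unfolding q by (auto simp: C)
    then show ?thesis ..
  next
    case True
    then obtain j where j: "Clique j \<in> set p" by blast
    define T where "T = {i. \<exists>v. Copy i v \<in> set p}"
    have T: "i \<in> {1..n}" "Clique i \<in> set p" "hd p \<in> range (Copy i) \<or> last p \<in> range (Copy i)"
      if i: "i \<in> T" for i
    proof -
      obtain v where v: "Copy i v \<in> set p"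
        using i by (auto simp: T_def)
      show "i \<in> {1..n}"
        using v verts by (auto simp: part_def)
      show "Clique i \<in> set p"
        using vpath_attach_Clique_mem[OF p sym v j] .
      show "hd p \<in> range (Copy i) \<or> last p \<in> range (Copy i)"
        using vpath_attach_end_in_Copy[OF p sym v] .
    qed
    have "\<exists>a \<in> {1..n}. Clique a \<in> set p \<and> (\<forall>b \<in> T. a \<notin> D b)"
    proof (cases "T = {}")
      case True
      then show ?thesis
        using j verts by (auto simp: part_def)
    next
      case False
      then obtain a where a: "a \<in> T" by blast
      show ?thesis
      proof (cases "\<exists>b \<in> T. a \<in> D b")
        case False
        then show ?thesis using T a by blast
      next
        case True
        then obtain b where b: "b \<in> T" "a \<in> D b" by blast
        then have "b \<noteq> a"
          using D(1) T by blast
        have disj: "range (Copy i) \<inter> range (Copy l) = {}" if "i \<noteq> l" for i l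
          using that by auto
        \<comment> \<open>Every copy met contains an end of the path, and the distinct copies
          \<open>a\<close> and \<open>b\<close> already account for both ends.\<close>
        have "c = a \<or> c = b" if "c \<in> T" for c
          using T(3)[OF that] T(3)[OF a] T(3)[OF b(1)] \<open>b \<noteq> a\<close> disj by blast
        then have "T \<subseteq> {a, b}"
          by blast
        \<comment> \<open>Color \<open>a\<close> fails because it may occur in copy
          \<open>b\<close>; but then \<open>b\<close> is not in \<open>D a\<close> by antisymmetry,
          nor in \<open>D b\<close>.\<close>
        then have "\<forall>c \<in> T. b \<notin> D c"
          using D b T by blast
        then show ?thesis
          using b T by blast
      qed
    qed
    then obtain a where a: "a \<in> {1..n}" "Clique a \<in> set p" "\<And>b. b \<in> T \<Longrightarrow> a \<notin> D b"
      by blast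
    have "v = Clique a" if v: "v \<in> set p" "C v = e a" for v
    proof -
      have "v \<in> part {1..n} (pverts G)"
        using v verts by blast
      then consider i where "v = Clique i" "i \<in> {1..n}"
        | i w where "v = Copy i w" "i \<in> {1..n}" "w \<in> pverts G"
        by (auto simp: part_def)
      then show ?thesis
      proof cases
        case 1
        then have "e i = e a"
          using v(2) by (simp add: C)
        then show ?thesis
          using 1 a(1) inj_onD[OF e] by metis
      next
        case 2
        then have "C' i w = e a"
          using v(2) by (simp add: C)
        then have "e a \<in> e ` D i"
          using C'(1)[OF 2(2)] 2(3) by (metis imageI subsetD)
        then have "a \<in> D i"
          using e a sub[OF 2(2)] by (meson inj_on_image_mem_iff)
        moreover have "i \<in> T"
          using 2 v by (auto simp: T_def)
        ultimately show ?thesis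
          using a by blast
      qed
    qed
    moreover have "Clique a \<in> set p" "C (Clique a) = e a"
      using a(2) C(1) by simp_all
    ultimately have "\<exists>!v. v \<in> set p \<and> C v = e a"
      by blast
    then show ?thesis ..
  qed
qed

lemma cf_on_H_exists:
  assumes r: "valid_choice r" and F: "finite F" "card F = 2 ^ (k + 1) - 1"
  shows "\<exists>C. C ` pverts (H r k) \<subseteq> F \<and> cf_on (H r k) C"
  using F
proof (induction k arbitrary: F)
  case 0
  then obtain c where c: "F = {c}"
    by (auto simp: card_1_singleton_iff)
  have "cf_on (H r 0) (\<lambda>_. c)"
    unfolding cf_on_def
  proof (intro allI impI)
    fix p assume "vpath p (with_proj (H r 0))"
    then have "set p = {Root}"
      by (rule vpath_H_0)
    then show "\<exists>d. \<exists>!v. v \<in> set p \<and> c = d" by auto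
  qed
  then show ?case
    using c by (intro exI[of _ "\<lambda>_. c"]) auto
next
  case (Suc k)
  define n :: nat where "n = 2 ^ (k + 2) - 1"
  have "2 ^ (k + 2) = 2 * (2::nat) ^ (k + 1)" "1 \<le> (2::nat) ^ (k + 1)"
    by simp_all
  \<comment> \<open>The out-degree of a regular tournament on \<open>n\<close> vertices is exactly
    the palette size that the induction hypothesis requires.\<close>
  then have "n = 2 * (2 ^ (k + 1) - 1) + 1"
    unfolding n_def by linarith
  then obtain D where D: "\<And>a. a \<in> {1..n} \<Longrightarrow> D a \<subseteq> {1..n} \<and> card (D a) = 2 ^ (k + 1) - 1 \<and> a \<notin> D a"
    and antisym: "\<And>a b. a \<in> D b \<Longrightarrow> b \<notin> D a"
    using regular_tournament by blast
  have "card {1..n} = card F"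
    using Suc.prems by (simp add: n_def)
  then obtain e where e: "bij_betw e {1..n} F"
    using Suc.prems finite_same_card_bij[of "{1..n}" F] by blast
  have "\<exists>C. C ` pverts (H r k) \<subseteq> e ` D i \<and> cf_on (H r k) C" if i: "i \<in> {1..n}" for i
  proof (rule Suc.IH)
    show "finite (e ` D i)"
      using D[OF i] finite_subset by blast
    show "card (e ` D i) = 2 ^ (k + 1) - 1"
      using D[OF i] e by (metis bij_betw_def card_image inj_on_subset)
  qed
  then obtain C' where C': "\<And>i. i \<in> {1..n} \<Longrightarrow> C' i ` pverts (H r k) \<subseteq> e ` D i"
      "\<And>i. i \<in> {1..n} \<Longrightarrow> cf_on (H r k) (C' i)"
    by metis
  define C where "C = (\<lambda>v. case v of Root \<Rightarrow> 0 | Clique i \<Rightarrow> e i | Copy i w \<Rightarrow> C' i w)"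
  have H: "H r (Suc k) = attach n (r (Suc k)) (H r k)"
    by (simp add: n_def)
  have "cf_on (H r (Suc k)) C"
    unfolding H
  proof (rule cf_on_attach[where D = D and e = e and C' = C'])
    show "sym (parcs (attach n (r (Suc k)) (H r k)))"
      using sym_parcs_H[OF r, of "Suc k"] H by simp
    show "inj_on e {1..n}"
      using e by (simp add: bij_betw_def)
  qed (use D antisym C' in \<open>auto simp: C_def\<close>)
  moreover have "C v \<in> F" if "v \<in> pverts (H r (Suc k))" for v
  proof -
    have v: "v \<in> pverts (attach n (r (Suc k)) (H r k))"
      using that H by simp
    have eF: "e ` {1..n} = F"
      using e by (simp add: bij_betw_def)
    from v show ?thesis
    proof (cases rule: vertex_attach_cases)
      case (1 i)
      then show ?thesis using eF by (auto simp: C_def)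
    next
      case (2 i w)
      then have "C' i w \<in> e ` D i"
        using C' by blast
      then show ?thesis
        using D[OF 2(2)] 2 eF by (auto simp: C_def)
    qed
  qed
  ultimately show ?case by blast
qed

section \<open>The two chromatic numbers and the limit of their ratio\<close>

lemma chi_cf_H:
  assumes "valid_choice r"
  shows "chi_cf (H r (Suc k)) = 2 ^ (k + 2) - 1"
  unfolding chi_cf_def
proof (rule Least_equality)
  show "\<exists>C. cf_coloring (H r (Suc k)) (2 ^ (k + 2) - 1) C"
    using cf_on_H_exists[OF assms, of "{1..2 ^ (k + 2) - 1}" "Suc k"]
    unfolding cf_coloring_iff by simp
  show "2 ^ (k + 2) - 1 \<le> l" if "\<exists>C. cf_coloring (H r (Suc k)) l C" for l
    using that cf_coloring_clique_card_le unfolding H.simps by blast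
qed

lemma chi_um_H_bounds:
  assumes "valid_choice r"
  shows "chi_um (H r k) \<le> 2 ^ (k + 2) - k - 3" "2 ^ (k + 2) \<le> chi_um (H r k) + 2 * k + 3"
proof -
  show "chi_um (H r k) \<le> 2 ^ (k + 2) - k - 3"
    unfolding chi_um_def using um_coloring_H_exists by (rule Least_le)
  have "\<exists>C. um_coloring (H r k) (chi_um (H r k)) C"
    unfolding chi_um_def using um_coloring_H_exists by (rule LeastI)
  then obtain C where C: "C ` pverts (H r k) \<subseteq> {1..chi_um (H r k)}" "um_on (H r k) C"
    unfolding um_coloring_iff by blast
  have "card (C ` pverts (H r k)) \<le> chi_um (H r k)"
    using card_mono[OF _ C(1)] by simp
  then show "2 ^ (k + 2) \<le> chi_um (H r k) + 2 * k + 3"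
    using um_on_H_card_ge[OF assms C(2)] by linarith
qed

theorem theorem2:
  fixes r :: "nat \<Rightarrow> nat \<Rightarrow> vertex"
  assumes "valid_choice r"
  shows "(\<lambda>k. real (chi_um (H r k)) / real (chi_cf (H r k))) \<longlonglongrightarrow> 2"
\<comment> \<open>The index is shifted because \<open>chi_cf_H\<close> gives the denominator only
  from index 1 on.\<close>
proof (rule LIMSEQ_imp_Suc, rule real_tendsto_sandwich)
  let ?q = "\<lambda>k. real (chi_um (H r (Suc k))) / real (chi_cf (H r (Suc k)))"
  have cf: "real (chi_cf (H r (Suc k))) = 2 ^ (k + 2) - 1" for k
    using chi_cf_H[OF assms, of k] by (simp add: of_nat_diff)
  have pos: "2 ^ (k + 2) - (1::real) > 0" for k
    using one_less_power[of "2::real" "k + 2"] by simp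
  have "real (2 ^ (Suc k + 2)) \<le> real (chi_um (H r (Suc k)) + 2 * Suc k + 3)" for k
    using chi_um_H_bounds(2)[OF assms] of_nat_le_iff by blast
  then have "2 ^ (k + 3) - 2 * real k - 5 \<le> real (chi_um (H r (Suc k)))" for k
    by (simp add: algebra_simps numeral_3_eq_3 del: H.simps)
  then have "(2 ^ (k + 3) - 2 * real k - 5) / (2 ^ (k + 2) - 1) \<le> ?q k" for k
    unfolding cf using less_imp_le[OF pos] by (rule divide_right_mono)
  then show "\<forall>\<^sub>F k in sequentially. (2 ^ (k + 3) - 2 * real k - 5) / (2 ^ (k + 2) - 1) \<le> ?q k"
    by simp
  have "chi_um (H r (Suc k)) \<le> 2 ^ (k + 3)" for k
    using chi_um_H_bounds(1)[OF assms, of "Suc k"] by (simp add: numeral_3_eq_3 del: H.simps)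
  then have "real (chi_um (H r (Suc k))) \<le> real (2 ^ (k + 3))" for k
    by (rule of_nat_mono)
  then have "real (chi_um (H r (Suc k))) \<le> 2 ^ (k + 3)" for k
    by (simp del: H.simps)
  then have "?q k \<le> 2 ^ (k + 3) / (2 ^ (k + 2) - 1)" for k
    unfolding cf using less_imp_le[OF pos] by (rule divide_right_mono)
  then show "\<forall>\<^sub>F k in sequentially. ?q k \<le> 2 ^ (k + 3) / (2 ^ (k + 2) - 1)"
    by simp
  \<comment> \<open>Both bounds behave like \<open>2 ^ (k + 3) / 2 ^ (k + 2)\<close>; the linear
    loss in the numerator is negligible.\<close>
  show "(\<lambda>k. (2 ^ (k + 3) - 2 * real k - 5) / (2 ^ (k + 2) - 1)) \<longlonglongrightarrow> 2"
    by real_asymp (simp add: exp_minus)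
  show "(\<lambda>k. 2 ^ (k + 3) / (2 ^ (k + 2) - 1 :: real)) \<longlonglongrightarrow> 2"
    by real_asymp (simp add: exp_minus)
qed

end
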